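(* Let $d,d',r,p$ be positive integers with $r,p$ even, let $f:\mathbb{R}^n\to\mathbb{R}^n$ be a polynomial vector field of degree at most $d_f$, let $g_1,\ldots,g_m$ be real polynomials on $\mathbb{R}^n$ with $\deg g_i\leq d_i$, and define $\Omega:=\{x\in\mathbb{R}^n\mid g_i(x)\geq0,\ i=1,\ldots,m\}$. For a prescribed $k\geq0$, suppose there exist $\gamma>0$ and a real polynomial $V$ on $\mathbb{R}^n$ of degree at most $2d$ satisfying $$V(x)-(x^Tx)^{r/2}\in\Sigma_{s,d}[\Omega],$$ $$\gamma(x^Tx)^{r/2}-V(x)\in\Sigma_{s,d}[\Omega],$$ $$-\frac{kr}{p}V(x)(x^Tx)^{p/2}-\nabla V(x)^Tf(x)\in\Sigma_{s,d'}[\Omega].$$ Then, for any $c\geq0$ such that $S_c(V)\subseteq\mathrm{int}(\Omega)$, where $S_c(V):=\{x\in\mathbb{R}^n\mid V(x)\leq c\}$, $f$ is rationally stable on $S_c(V)$ with power $p$, rate $k$, and gain $M:=\gamma^{p/r}$.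
   Context: SOS polynomials: $\Sigma_{s,d}$ is the set of sum-of-squares polynomials of degree at most $2d$, i.e. polynomials $s(x)=Z_d(x)^TPZ_d(x)$ with $P\succeq0$, where $Z_d$ is the vector of monomials in $x$ of degree at most $d$. For $\Omega=\{x\in\mathbb{R}^n\mid g_i(x)\geq0,\ i=1,\ldots,m\}$, $\Sigma_{s,d}[\Omega]$ denotes the set of polynomials admitting an SOS certificate of nonnegativity on $\Omega$ of the form $s(x)=s_0(x)+\sum_{i=1}^m s_i(x)g_i(x)$, where $s_0,s_1,\ldots,s_m$ are SOS polynomials whose degrees are bounded by fixed prescribed values (depending on $d$ and the $d_i$); the claim is for any such choice of degree bounds. $\phi_f(x,t)$ denotes the solution at time $t$ of the ODE initialized at $x$: $\frac{\partial}{\partial t}\phi_f(x,t)=f(\phi_f(x,t))$, $\phi_f(x,0)=x$. Standing assumption: the solutions under consideration (those starting in $S_c(V)$) exist uniquely for all $t\geq0$ and depend continuously on their initial conditions. $\mathrm{int}(\Omega)$ is the topological interior. $f$ is rationally stable on a set $G$ with power $p$, rate $k$, and gain $M$ if $\|\phi_f(x,t)\|_2^p\leq M\frac{\|x\|_2^p}{1+\|x\|_2^p kt}$ for all $x\in G$ and $t\geq0$. The usual parameter range is $p,k>0$, $M\geq1$; the same inequality is used as the definition when $k=0$, or when $M>0$ is less than $1$ (possible here only in the vacuous case where $S_c(V)$ is empty). *)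

theory Defs
  imports "HOL-Analysis.Analysis"
begin

text \<open>
  Real polynomials in \<open>n = CARD('n)\<close> variables are represented by the polynomial functions they
  induce on \<open>real^'n\<close>; since the field of reals is infinite, this identification is injective and
  an equality of polynomials is a pointwise equality of functions.
\<close>

definition multi_indices :: "nat \<Rightarrow> ('n::finite \<Rightarrow> nat) set" where
  "multi_indices d = {\<alpha>. (\<Sum>i\<in>UNIV. \<alpha> i) \<le> d}"

definition mono_fun :: "('n::finite \<Rightarrow> nat) \<Rightarrow> real^'n \<Rightarrow> real" where
  "mono_fun \<alpha> x = (\<Prod>i\<in>UNIV. x $ i ^ \<alpha> i)"

definition polys_deg_le :: "nat \<Rightarrow> (real^'n::finite \<Rightarrow> real) set" where
  "polys_deg_le d = {p. \<exists>a. \<forall>x. p x = (\<Sum>\<alpha>\<in>multi_indices d. a \<alpha> * mono_fun \<alpha> x)}"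

lemma finite_multi_indices: "finite (multi_indices d :: ('n::finite \<Rightarrow> nat) set)"
proof (rule finite_subset)
  show "(multi_indices d :: ('n \<Rightarrow> nat) set) \<subseteq> PiE UNIV (\<lambda>_. {..d})"
  proof
    fix \<alpha> :: "'n \<Rightarrow> nat" assume "\<alpha> \<in> multi_indices d"
    then have "\<alpha> i \<le> d" for i
      using member_le_sum[of i UNIV \<alpha>] by (simp add: multi_indices_def)
    then show "\<alpha> \<in> PiE UNIV (\<lambda>_. {..d})" by auto
  qed
qed (simp add: finite_PiE)

definition psd_on :: "'a set \<Rightarrow> ('a \<Rightarrow> 'a \<Rightarrow> real) \<Rightarrow> bool" where
  "psd_on I P \<longleftrightarrow> (\<forall>\<alpha>\<in>I. \<forall>\<beta>\<in>I. P \<alpha> \<beta> = P \<beta> \<alpha>) \<and>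
     (\<forall>v. 0 \<le> (\<Sum>\<alpha>\<in>I. \<Sum>\<beta>\<in>I. v \<alpha> * P \<alpha> \<beta> * v \<beta>))"

text \<open>The quadratic forms \<open>Z\<^sub>d(x)\<^sup>T P Z\<^sub>d(x)\<close>, with \<open>P\<close> indexed by the monomials occurring in \<open>Z\<^sub>d\<close>.\<close>

definition sos_polys :: "nat \<Rightarrow> (real^'n::finite \<Rightarrow> real) set" where
  "sos_polys d = {s. \<exists>P. psd_on (multi_indices d) P \<and>
     (\<forall>x. s x = (\<Sum>\<alpha>\<in>multi_indices d. \<Sum>\<beta>\<in>multi_indices d.
                   mono_fun \<alpha> x * P \<alpha> \<beta> * mono_fun \<beta> x))}"

text \<open>
  Constraints are indexed by \<open>{1..m}\<close>. The number \<open>b d i\<close> is the prescribed bound on the degree of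
  the \<open>i\<close>-th SOS multiplier at level \<open>d\<close>, where \<open>i = 0\<close> is the free SOS term.
\<close>

definition sos_certified ::
    "(nat \<Rightarrow> nat \<Rightarrow> nat) \<Rightarrow> nat \<Rightarrow> (nat \<Rightarrow> real^'n::finite \<Rightarrow> real) \<Rightarrow> nat \<Rightarrow> (real^'n \<Rightarrow> real) set" where
  "sos_certified b m g d = {s. \<exists>\<sigma>.
     (\<forall>i\<in>{0..m}. \<sigma> i \<in> (\<Union>e. sos_polys e) \<and> \<sigma> i \<in> polys_deg_le (b d i)) \<and>
     (\<forall>x. s x = \<sigma> 0 x + (\<Sum>i=1..m. \<sigma> i x * g i x))}"

definition semialg_set :: "nat \<Rightarrow> (nat \<Rightarrow> real^'n::finite \<Rightarrow> real) \<Rightarrow> (real^'n) set" where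
  "semialg_set m g = {x. \<forall>i\<in>{1..m}. g i x \<ge> 0}"

definition sublevel :: "(real^'n::finite \<Rightarrow> real) \<Rightarrow> real \<Rightarrow> (real^'n) set" where
  "sublevel V c = {x. V x \<le> c}"

definition grad :: "(real^'n::finite \<Rightarrow> real) \<Rightarrow> real^'n \<Rightarrow> real^'n" where
  "grad V x = (THE D. GDERIV V x :> D)"

definition ode_solution ::
    "(real^'n::finite \<Rightarrow> real^'n) \<Rightarrow> real^'n \<Rightarrow> (real \<Rightarrow> real^'n) \<Rightarrow> bool" where
  "ode_solution f x y \<longleftrightarrow>
     y 0 = x \<and> (\<forall>t\<ge>0. (y has_vector_derivative f (y t)) (at t within {0..}))"

text \<open>
  The solution map \<open>\<phi>\<^sub>f\<close>. It is meaningful at \<open>x\<close> only when a solution from \<open>x\<close> exists for all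
  \<open>t \<ge> 0\<close> and is unique, which \<open>flow_well_posed_on\<close> guarantees.
\<close>

definition flow :: "(real^'n::finite \<Rightarrow> real^'n) \<Rightarrow> real^'n \<Rightarrow> real \<Rightarrow> real^'n" where
  "flow f x t = (THE v. \<exists>y. ode_solution f x y \<and> y t = v)"

definition flow_well_posed_on :: "(real^'n::finite \<Rightarrow> real^'n) \<Rightarrow> (real^'n) set \<Rightarrow> bool" where
  "flow_well_posed_on f G \<longleftrightarrow>
     (\<forall>x\<in>G. (\<exists>y. ode_solution f x y) \<and>
        (\<forall>y z. ode_solution f x y \<longrightarrow> ode_solution f x z \<longrightarrow> (\<forall>t\<ge>0. y t = z t))) \<and>
     (\<forall>t\<ge>0. continuous_on G (\<lambda>x. flow f x t))"

text \<open>
  No restriction on the range of the rate \<open>k\<close> and the gain \<open>M\<close> is built in, so that \<open>k = 0\<close> and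
  \<open>0 < M < 1\<close> are covered by the same inequality.
\<close>

definition rationally_stable ::
    "(real^'n::finite \<Rightarrow> real^'n) \<Rightarrow> (real^'n) set \<Rightarrow> nat \<Rightarrow> real \<Rightarrow> real \<Rightarrow> bool" where
  "rationally_stable f G p k M \<longleftrightarrow>
     (\<forall>x\<in>G. \<forall>t\<ge>0. norm (flow f x t) ^ p \<le> M * (norm x ^ p / (1 + norm x ^ p * k * t)))"

end

theory Submission
  imports Defs
begin

text \<open>
  Along a solution \<open>y\<close> put \<open>u t = V (y t)\<close>. While \<open>y\<close> is in \<open>\<Omega>\<close>, the third certificate makes \<open>u\<close>
  nonincreasing; since \<open>S\<^sub>c(V)\<close> is closed and lies in the interior of \<open>\<Omega>\<close>, the solution can never leave
  \<open>S\<^sub>c(V)\<close>. There the second certificate bounds \<open>\<parallel>y\<parallel>\<^sup>p\<close> below by \<open>(u / \<gamma>) powr (p / r)\<close>, whence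
  \<open>u powr (- p / r)\<close> grows at rate at least \<open>k \<gamma> powr (- p / r)\<close>. Integrating this and sandwiching
  \<open>u\<close> between \<open>\<parallel>y\<parallel>\<^sup>r\<close> and \<open>\<gamma> \<parallel>y\<parallel>\<^sup>r\<close> gives the claim.
\<close>

lemma poly_differentiable:
  fixes q :: "real^'n::finite \<Rightarrow> real"
  assumes "q \<in> polys_deg_le e"
  shows "q differentiable at x"
proof -
  obtain a where "\<forall>x. q x = (\<Sum>\<alpha>\<in>multi_indices e. a \<alpha> * mono_fun \<alpha> x)"
    using assms by (auto simp: polys_deg_le_def)
  then have "q = (\<lambda>x. \<Sum>\<alpha>\<in>multi_indices e. a \<alpha> * (\<Prod>i\<in>UNIV. x $ i ^ \<alpha> i))"
    by (auto simp: mono_fun_def)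
  moreover have "(\<lambda>x::real^'n. x $ i) differentiable at x" for i
    by (rule bounded_linear_imp_differentiable) (rule bounded_linear_vec_nth)
  then have "(\<lambda>x::real^'n. x $ i ^ j) differentiable at x" for i j
    by (rule differentiable_power)
  then obtain D where "((\<lambda>x::real^'n. x $ i ^ j) has_derivative D i j) (at x)" for i j
    unfolding differentiable_def by metis
  then have "(\<lambda>x::real^'n. \<Prod>i\<in>UNIV. x $ i ^ \<alpha> i) differentiable at x" for \<alpha>
    by (intro differentiableI[OF has_derivative_prod]) blast
  ultimately show ?thesis
    by (auto intro!: differentiable_sum differentiable_mult simp: finite_multi_indices)
qed

text \<open>\<open>grad\<close> is a definite description, so a gradient must be shown to exist and
  to be unique. A linear functional is the inner product with the vector \<open>D\<close> assembled
  from its values on the basis, and a vector is determined by its inner products.\<close>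

lemma has_derivative_grad:
  fixes q :: "real^'n::finite \<Rightarrow> real"
  assumes "q differentiable at x"
  shows "(q has_derivative (\<lambda>h. grad q x \<bullet> h)) (at x)"
proof -
  obtain q' where q': "(q has_derivative q') (at x)"
    using assms by (auto simp: differentiable_def)
  define D where "D = (\<Sum>i\<in>Basis. q' i *\<^sub>R i)"
  interpret linear q' using q' by (rule has_derivative_linear)
  have "q' = (\<lambda>h. h \<bullet> D)"
  proof
    fix h
    have "q' h = q' (\<Sum>i\<in>Basis. (h \<bullet> i) *\<^sub>R i)"
      by (simp add: euclidean_representation)
    also have "\<dots> = h \<bullet> D"
      by (simp add: sum scale D_def inner_sum_right mult.commute)
    finally show "q' h = h \<bullet> D" .
  qed
  with q' have D: "GDERIV q x :> D"
    by (simp add: gderiv_def)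
  have "E = D" if "GDERIV q x :> E" for E
  proof -
    have "(\<lambda>h. h \<bullet> E) = (\<lambda>h. h \<bullet> D)"
      using that D unfolding gderiv_def by (rule has_derivative_unique)
    then show ?thesis
      by (metis vector_eq_ldot)
  qed
  with D have "grad q x = D"
    unfolding grad_def by blast
  with D show ?thesis
    by (simp add: gderiv_def inner_commute)
qed

lemma sos_polys_nonneg: "s \<in> sos_polys e \<Longrightarrow> 0 \<le> s x"
  by (auto simp: sos_polys_def psd_on_def)

lemma sos_certified_nonneg:
  assumes "s \<in> sos_certified b m g e" and "x \<in> semialg_set m g"
  shows "0 \<le> s x"
proof -
  obtain \<sigma> where \<sigma>: "\<And>i. i \<in> {0..m} \<Longrightarrow> \<sigma> i \<in> (\<Union>e. sos_polys e)"
    and s: "s x = \<sigma> 0 x + (\<Sum>i=1..m. \<sigma> i x * g i x)"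
    using assms(1) unfolding sos_certified_def by blast
  have "0 \<le> \<sigma> i x" if "i \<in> {0..m}" for i
    using \<sigma>[OF that] sos_polys_nonneg by blast
  then show ?thesis
    using assms(2) unfolding s semialg_set_def
    by (intro add_nonneg_nonneg sum_nonneg mult_nonneg_nonneg) auto
qed

text \<open>Continuous induction. The times in \<open>{0..t}\<close> at which \<open>u\<close> is
  below the threshold form a closed set \<open>A\<close>, so \<open>Sup A\<close> belongs to it, and
  \<open>step\<close> applied there would reach beyond \<open>Sup A\<close> unless
  \<open>Sup A = t\<close>.\<close>

lemma le_threshold_forward:
  fixes u :: "real \<Rightarrow> real"
  assumes "continuous_on {0..} u" and "u 0 \<le> c"
    and step: "\<And>t. 0 \<le> t \<Longrightarrow> u t \<le> c \<Longrightarrow> \<exists>e>0. \<forall>s\<in>{t..t + e}. u s \<le> c"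
    and "0 \<le> t"
  shows "u t \<le> c"
proof (rule ccontr)
  assume neg: "\<not> u t \<le> c"
  define A where "A = {0..t} \<inter> u -` {..c}"
  have "closed A"
    unfolding A_def
    by (rule continuous_closed_preimage) (auto intro: continuous_on_subset[OF assms(1)])
  moreover have "0 \<in> A" and bdd: "bdd_above A"
    using assms by (auto simp: A_def intro!: bdd_aboveI[of _ t])
  ultimately have "Sup A \<in> A"
    by (metis closed_contains_Sup empty_iff)
  then obtain e where "e > 0" and e: "\<And>s. s \<in> {Sup A..Sup A + e} \<Longrightarrow> u s \<le> c"
    using step[of "Sup A"] by (auto simp: A_def)
  \<comment> \<open>Capping at \<open>t\<close> keeps \<open>s\<close> in \<open>{0..t}\<close>,
    hence in \<open>A\<close>. Then \<open>s \<le> Sup A\<close> together with \<open>e > 0\<close>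
    excludes the second argument of \<open>min\<close>.\<close>
  define s where "s = min t (Sup A + e)"
  have "Sup A \<le> t" and "0 \<le> Sup A"
    using \<open>Sup A \<in> A\<close> by (auto simp: A_def)
  then have "u s \<le> c" and s: "s \<in> {0..t}" and "Sup A \<le> s"
    using \<open>e > 0\<close> e[of s] by (auto simp: s_def)
  then have "s \<in> A" by (simp add: A_def)
  then have "s \<le> Sup A" using bdd by (rule cSup_upper)
  then have "s = t" using \<open>e > 0\<close> by (auto simp: s_def min_def split: if_splits)
  with \<open>u s \<le> c\<close> neg show False by simp
qed

text \<open>The Bernoulli substitution \<open>v = u powr (- q)\<close> turns the differential
  inequality into \<open>v' \<ge> K\<close>, so \<open>v\<close> grows at least linearly; taking
  reciprocals gives the bound. In the proof, \<open>w s = K * s - v s\<close> is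
  nonincreasing.\<close>

lemma bernoulli_inequality_bound:
  fixes u u' :: "real \<Rightarrow> real"
  assumes "0 \<le> t" and "0 < q" and "0 \<le> K" and "continuous_on {0..t} u"
    and pos: "\<And>s. s \<in> {0..t} \<Longrightarrow> 0 < u s"
    and deriv: "\<And>s. 0 < s \<Longrightarrow> s < t \<Longrightarrow> (u has_real_derivative u' s) (at s)"
    and le: "\<And>s. 0 < s \<Longrightarrow> s < t \<Longrightarrow> u' s \<le> - (K / q) * u s * u s powr q"
  shows "u t powr q \<le> u 0 powr q / (1 + u 0 powr q * K * t)"
proof -
  define w where "w s = K * s - u s powr (- q)" for s
  have "w t \<le> w 0"
  proof (rule DERIV_nonpos_imp_decreasing_open[OF \<open>0 \<le> t\<close>])
    fix s assume s: "0 < s" "s < t"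
    then have us: "0 < u s" using pos by simp
    have "(w has_real_derivative K + q * u s powr (- q - 1) * u' s) (at s)"
      unfolding w_def
      by (rule derivative_eq_intros deriv[OF s] us refl | simp add: us)+
    moreover have "K + q * u s powr (- q - 1) * u' s \<le> 0"
    proof -
      have "u s powr (- q - 1) * (u s * u s powr q) = 1"
        using us by (simp add: powr_diff powr_minus field_simps)
      moreover have "q * u s powr (- q - 1) * u' s
          \<le> q * u s powr (- q - 1) * (- (K / q) * u s * u s powr q)"
        using le[OF s] \<open>0 < q\<close> by (intro mult_left_mono) auto
      moreover have "q * u s powr (- q - 1) * (- (K / q) * u s * u s powr q)
          = - K * (u s powr (- q - 1) * (u s * u s powr q))"
        using \<open>0 < q\<close> by (simp add: field_simps)
      ultimately show ?thesis by simp
    qed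
    ultimately show "\<exists>y. (w has_real_derivative y) (at s) \<and> y \<le> 0" by blast
  next
    show "continuous_on {0..t} w"
      unfolding w_def using pos assms(4)
      by (intro continuous_intros) force+
  qed
  then have ineq: "1 / u 0 powr q + K * t \<le> 1 / u t powr q"
    by (simp add: w_def powr_minus field_simps)
  have p0: "0 < u 0 powr q" "0 < u t powr q" using pos[of 0] pos[of t] \<open>0 \<le> t\<close> by auto
  have "u t powr q = 1 / (1 / u t powr q)" by simp
  also have "\<dots> \<le> 1 / (1 / u 0 powr q + K * t)"
    using ineq p0 \<open>0 \<le> K\<close> \<open>0 \<le> t\<close> by (intro divide_left_mono) (auto simp: add_pos_nonneg simp del: times_divide_eq_right)
  also have "\<dots> = u 0 powr q / (1 + u 0 powr q * K * t)"
    using p0 by (simp add: field_simps)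
  finally show ?thesis .
qed

text \<open>After cross-multiplication the terms \<open>a * b * c\<close> cancel and
  \<open>a \<le> b\<close> remains. This later allows an initial value to be replaced by an upper
  bound for it.\<close>

lemma divide_one_plus_mono:
  fixes a b c :: real
  assumes "0 \<le> a" and "a \<le> b" and "0 \<le> c"
  shows "a / (1 + a * c) \<le> b / (1 + b * c)"
proof -
  have "0 < 1 + a * c" and "0 < 1 + b * c"
    using assms by (auto intro!: add_pos_nonneg)
  then show ?thesis
    using assms(2) by (simp add: divide_simps) (simp add: algebra_simps)
qed

lemma flow_eqI:
  assumes "flow_well_posed_on f G" and "x \<in> G" and y: "ode_solution f x y" and "0 \<le> t"
  shows "flow f x t = y t"
  unfolding flow_def
proof (rule the_equality)
  show "\<exists>z. ode_solution f x z \<and> z t = y t" using y by blast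
next
  fix v assume "\<exists>z. ode_solution f x z \<and> z t = v"
  then show "v = y t" using assms unfolding flow_well_posed_on_def by metis
qed

lemma inner_self_power_half: "even j \<Longrightarrow> (x \<bullet> x) ^ (j div 2) = norm x ^ j"
  by (simp add: dot_square_norm power_mult[symmetric])

lemma ode_solution_continuous:
  "ode_solution f x y \<Longrightarrow> continuous_on {0..} y"
  unfolding ode_solution_def continuous_on_eq_continuous_within
  using has_vector_derivative_continuous by fastforce

text \<open>Chain rule at positive times only: at time 0 the solution has merely a one-sided
  derivative. Monotonicity arguments cover that endpoint by continuity.\<close>

lemma ode_solution_compose_deriv:
  fixes V :: "real^'n::finite \<Rightarrow> real"
  assumes "ode_solution f x y" and "\<And>z. V differentiable at z" and "0 < t"
  shows "((\<lambda>t. V (y t)) has_real_derivative grad V (y t) \<bullet> f (y t)) (at t)"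
proof -
  have "(y has_vector_derivative f (y t)) (at t within {0..})"
    using assms by (auto simp: ode_solution_def)
  moreover have "at t within {0..} = at t"
    using \<open>0 < t\<close> by (intro at_within_interior) auto
  ultimately have "(y has_derivative (\<lambda>h. h *\<^sub>R f (y t))) (at t)"
    by (simp add: has_vector_derivative_def)
  from has_derivative_compose[OF this has_derivative_grad[OF assms(2)]]
  show ?thesis
    by (simp add: has_field_derivative_def mult.commute[of _ "grad V (y t) \<bullet> f (y t)"])
qed

theorem corollary10:
  fixes f :: "real^'n::finite \<Rightarrow> real^'n"
    and g :: "nat \<Rightarrow> real^'n \<Rightarrow> real"
    and V :: "real^'n \<Rightarrow> real"
    and d d' r p d\<^sub>f m :: nat
    and dg :: "nat \<Rightarrow> nat"
    and b :: "nat \<Rightarrow> nat \<Rightarrow> nat"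
    and k \<gamma> c :: real
  assumes "d > 0" and "d' > 0" and "r > 0" and "p > 0" and "even r" and "even p"
    and "\<And>i. (\<lambda>x. f x $ i) \<in> polys_deg_le d\<^sub>f"
    and "\<And>i. i \<in> {1..m} \<Longrightarrow> g i \<in> polys_deg_le (dg i)"
    and "k \<ge> 0" and "\<gamma> > 0"
    and "V \<in> polys_deg_le (2 * d)"
    and "(\<lambda>x. V x - (x \<bullet> x) ^ (r div 2)) \<in> sos_certified b m g d"
    and "(\<lambda>x. \<gamma> * (x \<bullet> x) ^ (r div 2) - V x) \<in> sos_certified b m g d"
    and "(\<lambda>x. - (k * real r / real p) * V x * (x \<bullet> x) ^ (p div 2) - grad V x \<bullet> f x)
           \<in> sos_certified b m g d'"
    and "c \<ge> 0"
    and "sublevel V c \<subseteq> interior (semialg_set m g)"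
    and "flow_well_posed_on f (sublevel V c)"
  shows "rationally_stable f (sublevel V c) p k (\<gamma> powr (real p / real r))"
proof -
  define \<Omega> where "\<Omega> = semialg_set m g"
  \<comment> \<open>The three certificates, read pointwise on \<Omega>; evenness of \<open>r\<close>
    and \<open>p\<close> turns the powers of \<open>z \<bullet> z\<close> into powers of the
    norm.\<close>
  have lower: "norm z ^ r \<le> V z" and upper: "V z \<le> \<gamma> * norm z ^ r"
    and decr: "grad V z \<bullet> f z \<le> - (k * real r / real p) * V z * norm z ^ p" if "z \<in> \<Omega>" for z
    using that assms(5,6) sos_certified_nonneg[OF assms(12), of z]
      sos_certified_nonneg[OF assms(13), of z] sos_certified_nonneg[OF assms(14), of z]
    by (simp_all add: \<Omega>_def inner_self_power_half)
  have diffV: "V differentiable at z" for z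
    using assms(11) by (rule poly_differentiable)
  have contV: "continuous_on UNIV V"
    using diffV by (simp add: differentiable_imp_continuous_on differentiable_on_def
        differentiable_at_withinI)
  have sub_int: "z \<in> interior \<Omega>" if "V z \<le> c" for z
    using that assms(16) by (auto simp: \<Omega>_def sublevel_def)
  \<comment> \<open>The exponent that converts \<open>r\<close>-th powers of the norm, which bound
    \<open>V\<close>, into \<open>p\<close>-th powers.\<close>
  define q where "q = real p / real r"
  have "0 < q" using assms by (simp add: q_def)
  have root: "(norm z ^ r) powr q = norm z ^ p" for z :: "real^'n"
  proof (cases "z = 0")
    case False
    then show ?thesis
      using assms(3) by (simp add: powr_realpow[symmetric] powr_powr q_def)
  qed (use assms(3,4) in \<open>simp add: power_0_left\<close>)
  show ?thesis
    unfolding rationally_stable_def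
  proof (intro ballI allI impI)
    fix x :: "real^'n" and t :: real
    assume x: "x \<in> sublevel V c" and "0 \<le> t"
    obtain y where y: "ode_solution f x y"
      using assms(17) x unfolding flow_well_posed_on_def by blast
    then have "y 0 = x" by (simp add: ode_solution_def)
    define u where "u t = V (y t)" for t
    have conty: "continuous_on {0..} y" using y by (rule ode_solution_continuous)
    then have contu: "continuous_on {0..} u"
      unfolding u_def by (rule continuous_on_compose2[OF contV]) simp
    have du: "(u has_real_derivative grad V (y s) \<bullet> f (y s)) (at s)" if "0 < s" for s
      unfolding u_def using y diffV that by (rule ode_solution_compose_deriv)
    have nonpos: "grad V z \<bullet> f z \<le> 0" if "z \<in> \<Omega>" for z
    proof -
      have "0 \<le> V z" using lower[OF that] by (rule order_trans[rotated]) simp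
      then have "0 \<le> (k * real r / real p) * V z * norm z ^ p"
        using assms(9) by simp
      with decr[OF that] show ?thesis by simp
    qed
    \<comment> \<open>Membership in \<Omega> is demanded only strictly between \<open>s\<close> and
      \<open>s'\<close>, so the fact is available before invariance of the sublevel set is
      known.\<close>
    have u_mono: "u s' \<le> u s"
      if "0 \<le> s" "s \<le> s'" and \<Omega>: "\<And>\<tau>. s < \<tau> \<Longrightarrow> \<tau> < s' \<Longrightarrow> y \<tau> \<in> \<Omega>" for s s'
    proof (rule DERIV_nonpos_imp_decreasing_open[OF \<open>s \<le> s'\<close>])
      fix \<tau> assume "s < \<tau>" "\<tau> < s'"
      then show "\<exists>D. (u has_real_derivative D) (at \<tau>) \<and> D \<le> 0"
        using du[of \<tau>] nonpos[OF \<Omega>] \<open>0 \<le> s\<close> by fastforce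
    next
      show "continuous_on {s..s'} u"
        using \<open>0 \<le> s\<close> by (auto intro: continuous_on_subset[OF contu])
    qed
    have inv: "u s \<le> c" if "0 \<le> s" for s
      using contu _ _ that
    proof (rule le_threshold_forward)
      show "u 0 \<le> c" using x by (simp add: u_def \<open>y 0 = x\<close> sublevel_def)
    next
      fix s assume s: "0 \<le> s" "u s \<le> c"
      then have "y s \<in> interior \<Omega>" using sub_int by (simp add: u_def)
      then obtain \<epsilon> where "0 < \<epsilon>" and \<epsilon>: "ball (y s) \<epsilon> \<subseteq> \<Omega>"
        by (auto simp: mem_interior)
      obtain \<delta> where "0 < \<delta>" and \<delta>: "\<And>\<tau>. 0 \<le> \<tau> \<Longrightarrow> dist \<tau> s < \<delta> \<Longrightarrow> dist (y \<tau>) (y s) < \<epsilon>"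
        using conty s(1) \<open>0 < \<epsilon>\<close> unfolding continuous_on_iff by (metis atLeast_iff)
      \<comment> \<open>The closed interval up to \<open>s + \<delta>\<close> is admissible: each
        \<open>\<tau> < s'\<close> is at distance strictly less than \<open>\<delta>\<close> from
        \<open>s\<close>, so \<open>y \<tau>\<close> lies in the ball.\<close>
      have "u s' \<le> c" if "s' \<in> {s..s + \<delta>}" for s'
      proof -
        have "u s' \<le> u s"
        proof (rule u_mono)
          fix \<tau> assume "s < \<tau>" "\<tau> < s'"
          then have "dist (y \<tau>) (y s) < \<epsilon>"
            using that s(1) by (intro \<delta>) (auto simp: dist_real_def)
          then show "y \<tau> \<in> \<Omega>" using \<epsilon> by (auto simp: dist_commute)
        qed (use s that in auto)
        with s show ?thesis by simp
      qed
      with \<open>0 < \<delta>\<close> show "\<exists>e>0. \<forall>s'\<in>{s..s + e}. u s' \<le> c" by blast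
    qed
    have in\<Omega>: "y s \<in> \<Omega>" if "0 \<le> s" for s
      using sub_int inv[OF that] interior_subset by (auto simp: u_def)
    have lower_u: "norm (y s) ^ r \<le> u s" and upper_u: "u s \<le> \<gamma> * norm (y s) ^ r"
      if "0 \<le> s" for s
      using lower upper in\<Omega>[OF that] by (auto simp: u_def)
    have norm_le: "norm (y t) ^ p \<le> u t powr q"
      using powr_mono2[OF _ _ lower_u[OF \<open>0 \<le> t\<close>], of q] \<open>0 < q\<close> by (simp add: root)
    have le_norm: "u s powr q \<le> \<gamma> powr q * norm (y s) ^ p" if "0 \<le> s" for s
    proof -
      have "0 \<le> u s" using lower_u[OF that] by (rule order_trans[rotated]) simp
      then have "u s powr q \<le> (\<gamma> * norm (y s) ^ r) powr q"
        using upper_u[OF that] \<open>0 < q\<close> by (intro powr_mono2) auto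
      then show ?thesis
        using \<open>\<gamma> > 0\<close> by (simp add: powr_mult root)
    qed
    define M where "M = \<gamma> powr q"
    have "0 < M" using \<open>\<gamma> > 0\<close> by (simp add: M_def)
    have "u t powr q \<le> M * (norm x ^ p / (1 + norm x ^ p * k * t))"
    \<comment> \<open>The Bernoulli bound needs \<open>u > 0\<close> on all of
      \<open>{0..t}\<close>; as \<open>u\<close> is nonincreasing, positivity at \<open>t\<close>
      suffices. Otherwise \<open>u t = 0\<close> and the left side is
      \<open>0 powr q = 0\<close>.\<close>
    proof (cases "u t > 0")
      case True
      \<comment> \<open>The rate is \<open>k / M\<close> because the upper certificate yields only
        \<open>norm (y s) ^ p \<ge> u s powr q / M\<close>.\<close>
      have "u t powr q \<le> u 0 powr q / (1 + u 0 powr q * (k / M) * t)"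
      proof (rule bernoulli_inequality_bound[where u' = "\<lambda>s. grad V (y s) \<bullet> f (y s)"])
        show "continuous_on {0..t} u" by (auto intro: continuous_on_subset[OF contu])
        show "0 < u s" if "s \<in> {0..t}" for s
          using True u_mono[of s t] that in\<Omega> by fastforce
        show "grad V (y s) \<bullet> f (y s) \<le> - (k / M / q) * u s * u s powr q" if "0 < s" for s
        proof -
          have "0 \<le> u s" using lower_u[of s] that by (intro order_trans[OF _ lower_u]) auto
          have "u s powr q / M \<le> norm (y s) ^ p"
            using le_norm[of s] that \<open>0 < M\<close> by (simp add: M_def field_simps)
          then have "(k / q * u s) * (u s powr q / M) \<le> (k / q * u s) * norm (y s) ^ p"
            using \<open>0 \<le> u s\<close> \<open>0 < q\<close> assms(9) by (intro mult_left_mono) auto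
          moreover have "k * real r / real p = k / q" by (simp add: q_def)
          ultimately show ?thesis
            using decr[OF in\<Omega>, of s] that by (simp add: u_def ac_simps)
        qed
      qed (use \<open>0 \<le> t\<close> \<open>0 < q\<close> \<open>0 < M\<close> assms(9) du in auto)
      \<comment> \<open>Bounding \<open>u 0 powr q\<close> by \<open>M * norm x ^ p\<close> brings
        in a factor \<open>M\<close> that cancels the one in \<open>k / M\<close>, restoring the
        rate \<open>k\<close>.\<close>
      also have "\<dots> \<le> (M * norm x ^ p) / (1 + (M * norm x ^ p) * (k / M * t))"
        using divide_one_plus_mono[of "u 0 powr q" "M * norm x ^ p" "k / M * t"]
          le_norm[of 0] \<open>0 < M\<close> assms(9) \<open>0 \<le> t\<close>
        by (simp add: M_def \<open>y 0 = x\<close> mult.assoc)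
      also have "\<dots> = M * (norm x ^ p / (1 + norm x ^ p * k * t))"
        using \<open>0 < M\<close> by (simp add: field_simps)
      finally show ?thesis .
    next
      case False
      moreover have "0 \<le> u t"
        using lower_u[OF \<open>0 \<le> t\<close>] by (rule order_trans[rotated]) simp
      ultimately show ?thesis
        using \<open>0 < M\<close> assms(9) \<open>0 \<le> t\<close> by simp
    qed
    with norm_le show "norm (flow f x t) ^ p
        \<le> \<gamma> powr (real p / real r) * (norm x ^ p / (1 + norm x ^ p * k * t))"
      using flow_eqI[OF assms(17) x y \<open>0 \<le> t\<close>] by (simp add: M_def q_def)
  qed
qed

end
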